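(* Let $\{X_{n}\}_{n=1}^{\infty}$ be a sequence of pairwise independent random variables. Suppose there exist a random variable $X$ with $E|X| < \infty$ and a positive constant $C$ such that $$\sup_{n \geq 1} \frac{1}{n} \sum_{k=1}^{n} P(|X_{k}| > x) \leq C\, P(|X|>x) \quad \text{for all } x \geq 0.$$ Then $$\frac{S_{n} - ES_{n}}{n} \to 0 \quad \text{almost surely as } n \to \infty.$$
   Context: The random variables $X_n$, $n \geq 1$, are real-valued and defined on the same probability space; they are not assumed identically distributed. $S_{n}=\sum_{k=1}^{n} X_{k}$, $P$ denotes probability and $E$ denotes expectation. *)

theory Defs
  imports "HOL-Probability.Probability"
begin

end

theory Submission
  imports Defs
begin

text \<open>Etemadi's argument. The positive and negative parts satisfy the same hypotheses, so the variables
  may be taken nonnegative. By the layer-cake formula the averaged tail bound gives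
  \<open>(\<Sum>k=1..n. E (\<phi> (X k))) \<le> C * n * E (\<phi> Y)\<close> for nondecreasing continuous \<open>\<phi>\<close> with \<open>\<phi> 0 = 0\<close>. Along
  \<open>n = c * 2 ^ a\<close> with \<open>c\<close> fixed, truncate all of \<open>X 1, \<dots>, X n\<close> at the common level \<open>n\<close>: the variances of the
  truncated averages and the probabilities of an actual truncation are summable in \<open>a\<close>, both being
  bounded by \<open>C * E ((min Y n)\<^sup>2 / n)\<close>, and the mean lost is at most \<open>C * n * E (max (Y - n) 0)\<close>. This gives
  almost sure convergence along these sequences for all \<open>c\<close> simultaneously. As the partial sums are
  monotone and the grid becomes arbitrarily fine for large \<open>c\<close>, the full sequence converges.\<close>

section \<open>Layer-cake formula and comparison of integrals through tails\<close>

text \<open>Tonelli applied to the region under the graph of \<open>f\<close>, whose slice over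
  \<open>x\<close> is the interval \<open>{0..<f x}\<close> of length \<open>f x\<close>.\<close>

lemma nn_integral_layer_cake:
  fixes f :: "'a \<Rightarrow> real"
  assumes "sigma_finite_measure M" and [measurable]: "f \<in> borel_measurable M"
    and nonneg: "\<And>x. x \<in> space M \<Longrightarrow> 0 \<le> f x"
  shows "(\<integral>\<^sup>+x. f x \<partial>M) = (\<integral>\<^sup>+s. emeasure M {x\<in>space M. s < f x} * indicator {0..} s \<partial>lborel)"
proof -
  interpret M: sigma_finite_measure M by fact
  interpret pair_sigma_finite M "lborel :: real measure" ..
  define F :: "'a \<times> real \<Rightarrow> ennreal" where
    "F = (\<lambda>(x, s). indicator {0..} s * indicator {p\<in>space (M \<Otimes>\<^sub>M lborel). snd p < f (fst p)} (x, s))"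
  have [measurable]: "F \<in> borel_measurable (M \<Otimes>\<^sub>M lborel)"
    unfolding F_def by measurable
  have F_eq: "F (x, s) = indicator {0..<f x} s" if "x \<in> space M" for x s
    using that by (auto simp: F_def indicator_def space_pair_measure)
  have "(\<integral>\<^sup>+x. f x \<partial>M) = (\<integral>\<^sup>+x. (\<integral>\<^sup>+s. F (x, s) \<partial>lborel) \<partial>M)"
    by (intro nn_integral_cong) (simp add: F_eq nonneg)
  also have "\<dots> = (\<integral>\<^sup>+s. (\<integral>\<^sup>+x. F (x, s) \<partial>M) \<partial>lborel)"
    by (rule Fubini'[symmetric]) simp
  also have "\<dots> = (\<integral>\<^sup>+s. emeasure M {x\<in>space M. s < f x} * indicator {0..} s \<partial>lborel)"
  proof (intro nn_integral_cong)
    fix s :: real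
    have "(\<integral>\<^sup>+x. F (x, s) \<partial>M) = (\<integral>\<^sup>+x. indicator {0..} s * indicator {x\<in>space M. s < f x} x \<partial>M)"
      by (intro nn_integral_cong) (auto simp: F_eq indicator_def)
    also have "\<dots> = indicator {0..} s * emeasure M {x\<in>space M. s < f x}"
      by (subst nn_integral_cmult_indicator) auto
    finally show "(\<integral>\<^sup>+x. F (x, s) \<partial>M) = emeasure M {x\<in>space M. s < f x} * indicator {0..} s"
      by (simp add: mult.commute)
  qed
  finally show ?thesis .
qed

text \<open>Translates tails of \<open>\<phi> (X i)\<close> into tails of \<open>X i\<close>.
  Continuity makes the superlevel set open and monotonicity makes it an upper ray, so it has the
  strict form \<open>a < x\<close> of the tail hypothesis; \<open>\<phi> 0 = 0\<close> gives
  \<open>0 \<le> a\<close>.\<close>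

lemma mono_continuous_superlevel:
  fixes \<phi> :: "real \<Rightarrow> real"
  assumes mono: "mono \<phi>" and cont: "continuous_on UNIV \<phi>" and "\<phi> 0 = 0" and "0 \<le> s"
  obtains "\<And>x. \<not> s < \<phi> x" | a where "0 \<le> a" "\<And>x. s < \<phi> x \<longleftrightarrow> a < x"
proof (cases "\<exists>x. s < \<phi> x")
  case True
  define A where "A = {x. s < \<phi> x}"
  define a where "a = Inf A"
  have ne: "A \<noteq> {}" using True by (auto simp: A_def)
  have pos: "0 < x" if "x \<in> A" for x
    using that monoD[OF mono, of x 0] assms(3,4) by (force simp: A_def not_less)
  have bdd: "bdd_below A" using pos by (intro bdd_belowI[of _ 0]) force
  have op: "open A" unfolding A_def
    by (intro open_Collect_less continuous_intros cont)
  have iff: "x \<in> A \<longleftrightarrow> a < x" for x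
  proof
    assume x: "x \<in> A"
    \<comment> \<open>Openness puts a point of \<open>A\<close> strictly to the left of
      \<open>x\<close>, so the infimum is not attained.\<close>
    then obtain e where "e > 0" "ball x e \<subseteq> A" using op open_contains_ball by blast
    then have "x - e/2 \<in> A" by (auto simp: dist_real_def subset_eq)
    then have "a \<le> x - e/2" unfolding a_def using bdd by (rule cInf_lower)
    then show "a < x" using \<open>e > 0\<close> by simp
  next
    assume "a < x"
    then obtain y where "y \<in> A" "y < x" unfolding a_def using ne bdd cInf_less_iff by blast
    then show "x \<in> A" using monoD[OF mono, of y x] by (auto simp: A_def)
  qed
  have "0 \<le> a" unfolding a_def using ne pos by (intro cInf_greatest) (auto intro: less_imp_le)
  then show ?thesis using iff that(2)[of a] by (simp add: A_def)
qed (use that in blast)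

text \<open>At every level \<open>s\<close> the superlevel set of \<open>\<phi>\<close> is empty or
  a ray, so the tail hypothesis at the endpoint of the ray compares the two layer-cake integrands
  pointwise. Only distributions enter, so \<open>Y\<close> may live on another space.\<close>

lemma sum_nn_integral_le_of_tails:
  fixes X :: "'i \<Rightarrow> 'a \<Rightarrow> real" and Y :: "'b \<Rightarrow> real"
    and \<phi> :: "real \<Rightarrow> real"
  assumes "finite_measure M" "finite_measure N"
    and X[measurable]: "\<And>i. i \<in> I \<Longrightarrow> X i \<in> borel_measurable M" and [measurable]: "Y \<in> borel_measurable N"
    and X_nonneg: "\<And>i x. i \<in> I \<Longrightarrow> 0 \<le> X i x" and Y_nonneg: "\<And>x. 0 \<le> Y x"
    and "0 \<le> c"
    and tails: "\<And>t. 0 \<le> t \<Longrightarrow>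
      (\<Sum>i\<in>I. measure M {x\<in>space M. t < X i x}) \<le> c * measure N {x\<in>space N. t < Y x}"
    and \<phi>: "mono \<phi>" "continuous_on UNIV \<phi>" "\<phi> 0 = 0"
  shows "(\<Sum>i\<in>I. \<integral>\<^sup>+x. \<phi> (X i x) \<partial>M) \<le> ennreal c * (\<integral>\<^sup>+x. \<phi> (Y x) \<partial>N)"
proof -
  interpret M: finite_measure M by fact
  interpret N: finite_measure N by fact
  have [measurable]: "\<phi> \<in> borel_measurable borel"
    using \<phi>(2) by (rule borel_measurable_continuous_onI)
  have \<phi>_nonneg: "0 \<le> \<phi> x" if "0 \<le> x" for x
    using monoD[OF \<phi>(1) that] \<phi>(3) by simp
  have tails': "(\<Sum>i\<in>I. emeasure M {x\<in>space M. s < \<phi> (X i x)})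
      \<le> ennreal c * emeasure N {x\<in>space N. s < \<phi> (Y x)}" if "0 \<le> s" for s
  proof (rule mono_continuous_superlevel[OF \<phi> that])
    assume "\<And>x. \<not> s < \<phi> x"
    then show ?thesis by simp
  next
    fix a assume a: "0 \<le> a" "\<And>x. s < \<phi> x \<longleftrightarrow> a < x"
    have "(\<Sum>i\<in>I. emeasure M {x\<in>space M. a < X i x}) = ennreal (\<Sum>i\<in>I. measure M {x\<in>space M. a < X i x})"
      by (subst sum_ennreal[symmetric]) (auto simp: M.emeasure_eq_measure)
    also have "\<dots> \<le> ennreal (c * measure N {x\<in>space N. a < Y x})"
      using tails[OF a(1)] by (rule ennreal_leI)
    also have "\<dots> = ennreal c * emeasure N {x\<in>space N. a < Y x}"
      using \<open>0 \<le> c\<close> by (simp add: ennreal_mult N.emeasure_eq_measure)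
    finally show ?thesis by (simp add: a(2))
  qed
  have M_meas: "(\<lambda>s. emeasure M {x\<in>space M. s < f x}) \<in> borel_measurable lborel"
    if [measurable]: "f \<in> borel_measurable M" for f :: "'a \<Rightarrow> real"
    by measurable
  have N_meas: "(\<lambda>s. emeasure N {x\<in>space N. s < f x}) \<in> borel_measurable lborel"
    if [measurable]: "f \<in> borel_measurable N" for f :: "'b \<Rightarrow> real"
    by measurable
  have "(\<Sum>i\<in>I. \<integral>\<^sup>+x. \<phi> (X i x) \<partial>M)
      = (\<Sum>i\<in>I. \<integral>\<^sup>+s. emeasure M {x\<in>space M. s < \<phi> (X i x)} * indicator {0..} s \<partial>lborel)"
    by (intro sum.cong nn_integral_layer_cake)
       (auto intro: \<phi>_nonneg X_nonneg M.sigma_finite_measure_axioms)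
  also have "\<dots> = (\<integral>\<^sup>+s. (\<Sum>i\<in>I. emeasure M {x\<in>space M. s < \<phi> (X i x)} * indicator {0..} s) \<partial>lborel)"
    by (subst nn_integral_sum)
       (auto intro!: borel_measurable_times_ennreal M_meas measurable_compose[OF X])
  also have "\<dots> \<le> (\<integral>\<^sup>+s. ennreal c * (emeasure N {x\<in>space N. s < \<phi> (Y x)} * indicator {0..} s) \<partial>lborel)"
    by (intro nn_integral_mono) (auto simp: indicator_def tails')
  also have "\<dots> = ennreal c * (\<integral>\<^sup>+s. emeasure N {x\<in>space N. s < \<phi> (Y x)} * indicator {0..} s \<partial>lborel)"
    by (intro nn_integral_cmult borel_measurable_times_ennreal N_meas) auto
  also have "(\<integral>\<^sup>+s. emeasure N {x\<in>space N. s < \<phi> (Y x)} * indicator {0..} s \<partial>lborel) = (\<integral>\<^sup>+x. \<phi> (Y x) \<partial>N)"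
    by (intro nn_integral_layer_cake[symmetric])
       (auto intro: \<phi>_nonneg Y_nonneg N.sigma_finite_measure_axioms)
  finally show ?thesis .
qed

text \<open>Real-valued form: when the right side is finite, so is each nonnegative summand on the
  left, which makes integrability of every \<open>\<phi> (X i)\<close> a conclusion.\<close>

lemma integrable_of_tails:
  fixes X :: "'i \<Rightarrow> 'a \<Rightarrow> real" and Y :: "'b \<Rightarrow> real"
    and \<phi> :: "real \<Rightarrow> real"
  assumes "finite_measure M" "finite_measure N" and I: "finite I"
    and X[measurable]: "\<And>i. i \<in> I \<Longrightarrow> X i \<in> borel_measurable M" and Y[measurable]: "Y \<in> borel_measurable N"
    and X_nonneg: "\<And>i x. i \<in> I \<Longrightarrow> 0 \<le> X i x" and Y_nonneg: "\<And>x. 0 \<le> Y x"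
    and "0 \<le> c"
    and tails: "\<And>t. 0 \<le> t \<Longrightarrow>
      (\<Sum>i\<in>I. measure M {x\<in>space M. t < X i x}) \<le> c * measure N {x\<in>space N. t < Y x}"
    and \<phi>: "mono \<phi>" "continuous_on UNIV \<phi>" "\<phi> 0 = 0"
    and int: "integrable N (\<lambda>x. \<phi> (Y x))"
  shows "\<And>i. i \<in> I \<Longrightarrow> integrable M (\<lambda>x. \<phi> (X i x))"
    and "(\<Sum>i\<in>I. \<integral>x. \<phi> (X i x) \<partial>M) \<le> c * (\<integral>x. \<phi> (Y x) \<partial>N)"
proof -
  have [measurable]: "\<phi> \<in> borel_measurable borel"
    using \<phi>(2) by (rule borel_measurable_continuous_onI)
  have \<phi>_nonneg: "0 \<le> \<phi> x" if "0 \<le> x" for x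
    using monoD[OF \<phi>(1) that] \<phi>(3) by simp
  have "(\<Sum>i\<in>I. \<integral>\<^sup>+x. \<phi> (X i x) \<partial>M) \<le> ennreal c * (\<integral>\<^sup>+x. \<phi> (Y x) \<partial>N)"
    by (rule sum_nn_integral_le_of_tails) (fact | rule assms)+
  also have "\<dots> = ennreal (c * (\<integral>x. \<phi> (Y x) \<partial>N))"
    using \<open>0 \<le> c\<close> by (simp add: nn_integral_eq_integral[OF int] \<phi>_nonneg Y_nonneg ennreal_mult)
  finally have le: "(\<Sum>i\<in>I. \<integral>\<^sup>+x. \<phi> (X i x) \<partial>M) \<le> ennreal (c * (\<integral>x. \<phi> (Y x) \<partial>N))" .
  show integ: "integrable M (\<lambda>x. \<phi> (X i x))" if "i \<in> I" for i
  proof (rule integrableI_nonneg)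
    have "(\<integral>\<^sup>+x. \<phi> (X i x) \<partial>M) \<le> (\<Sum>i\<in>I. \<integral>\<^sup>+x. \<phi> (X i x) \<partial>M)"
      using I that by (intro member_le_sum) auto
    then show "(\<integral>\<^sup>+x. \<phi> (X i x) \<partial>M) < \<infinity>"
      using le by (auto intro: le_less_trans order_trans)
  qed (use that \<phi>_nonneg X_nonneg in auto)
  have "ennreal (\<Sum>i\<in>I. \<integral>x. \<phi> (X i x) \<partial>M) = (\<Sum>i\<in>I. \<integral>\<^sup>+x. \<phi> (X i x) \<partial>M)"
    by (simp add: nn_integral_eq_integral integ \<phi>_nonneg X_nonneg)
  with le have "ennreal (\<Sum>i\<in>I. \<integral>x. \<phi> (X i x) \<partial>M) \<le> ennreal (c * (\<integral>x. \<phi> (Y x) \<partial>N))"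
    by simp
  then show "(\<Sum>i\<in>I. \<integral>x. \<phi> (X i x) \<partial>M) \<le> c * (\<integral>x. \<phi> (Y x) \<partial>N)"
    by (subst (asm) ennreal_le_iff) (auto intro!: mult_nonneg_nonneg integral_nonneg_AE \<open>0 \<le> c\<close> simp: \<phi>_nonneg Y_nonneg)
qed

section \<open>Almost sure convergence and variances of pairwise independent sums\<close>

text \<open>The series of the \<open>f n\<close> has finite integral, so it converges at almost
  every point and its terms tend to 0 there.\<close>

lemma AE_tendsto_0_of_summable_integral:
  fixes f :: "nat \<Rightarrow> 'a \<Rightarrow> real"
  assumes int: "\<And>n. integrable M (f n)" and nonneg: "\<And>n x. 0 \<le> f n x"
    and sum: "summable (\<lambda>n. \<integral>x. f n x \<partial>M)"
  shows "AE x in M. (\<lambda>n. f n x) \<longlonglongrightarrow> 0"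
proof -
  have [measurable]: "f n \<in> borel_measurable M" for n
    using int by auto
  have "(\<integral>\<^sup>+x. (\<Sum>n. ennreal (f n x)) \<partial>M) = (\<Sum>n. \<integral>\<^sup>+x. f n x \<partial>M)"
    by (rule nn_integral_suminf) simp
  also have "\<dots> = (\<Sum>n. ennreal (\<integral>x. f n x \<partial>M))"
    by (simp add: nn_integral_eq_integral int nonneg)
  also have "\<dots> \<noteq> \<infinity>"
    using sum by (auto simp: suminf_ennreal2 nonneg)
  finally have "AE x in M. (\<Sum>n. ennreal (f n x)) \<noteq> \<infinity>"
    by (intro nn_integral_noteq_infinite) auto
  then show ?thesis
    by eventually_elim (auto intro!: summable_LIMSEQ_zero summable_suminf_not_top simp: nonneg)
qed

text \<open>After centring, independence of a pair makes its mixed product integrate to 0, so only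
  the diagonal of the double sum survives. The expansion involves just pairs, which is why pairwise
  independence suffices.\<close>

lemma (in prob_space) variance_sum_pairwise_indep:
  fixes Z :: "'i \<Rightarrow> 'a \<Rightarrow> real"
  assumes I: "finite I" and indep: "pairwise (\<lambda>i j. indep_var borel (Z i) borel (Z j)) I"
    and [measurable]: "\<And>i. i \<in> I \<Longrightarrow> Z i \<in> borel_measurable M"
    and sq: "\<And>i. i \<in> I \<Longrightarrow> integrable M (\<lambda>x. (Z i x)\<^sup>2)"
  shows "integrable M (\<lambda>x. ((\<Sum>i\<in>I. Z i x) - (\<Sum>i\<in>I. expectation (Z i)))\<^sup>2)"
    and "expectation (\<lambda>x. ((\<Sum>i\<in>I. Z i x) - (\<Sum>i\<in>I. expectation (Z i)))\<^sup>2) = (\<Sum>i\<in>I. variance (Z i))"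
proof -
  define W where "W i x = Z i x - expectation (Z i)" for i x
  have int: "integrable M (Z i)" if "i \<in> I" for i
    using square_integrable_imp_integrable[OF _ sq[OF that]] that by simp
  have W_sq: "integrable M (\<lambda>x. W i x * W i x)" if "i \<in> I" for i
    using sq[OF that] int[OF that] unfolding W_def
    by (simp add: algebra_simps power2_eq_square)
  have W_indep: "indep_var borel (W i) borel (W j)" if "i \<in> I" "j \<in> I" "i \<noteq> j" for i j
  proof -
    have "indep_var borel ((\<lambda>z. z - expectation (Z i)) \<circ> Z i) borel ((\<lambda>z. z - expectation (Z j)) \<circ> Z j)"
      using indep that by (intro indep_var_compose[where ?M1.0=borel and ?M2.0=borel]) (auto simp: pairwise_def)
    then show ?thesis by (simp add: W_def[abs_def] comp_def)
  qed
  have W_int: "integrable M (W i)" "expectation (W i) = 0" if "i \<in> I" for i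
    using int[OF that] by (simp_all add: W_def[abs_def] prob_space)
  have W_prod: "integrable M (\<lambda>x. W i x * W j x)" if "i \<in> I" "j \<in> I" for i j
    using indep_var_integrable[OF W_indep W_int(1) W_int(1)] W_sq that by (cases "i = j") auto
  have W_orth: "expectation (\<lambda>x. W i x * W j x) = (if i = j then variance (Z i) else 0)"
    if "i \<in> I" "j \<in> I" for i j
    using indep_var_lebesgue_integral[OF W_indep W_int(1) W_int(1), of i j] W_int(2)[of i] that
    by (cases "i = j") (simp_all add: W_def[abs_def] power2_eq_square)
  have eq: "((\<Sum>i\<in>I. Z i x) - (\<Sum>i\<in>I. expectation (Z i)))\<^sup>2 = (\<Sum>i\<in>I. \<Sum>j\<in>I. W i x * W j x)" for x
    by (simp add: W_def sum_subtractf[symmetric] power2_eq_square sum_product)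
  show "integrable M (\<lambda>x. ((\<Sum>i\<in>I. Z i x) - (\<Sum>i\<in>I. expectation (Z i)))\<^sup>2)"
    unfolding eq using W_prod by auto
  have "expectation (\<lambda>x. \<Sum>i\<in>I. \<Sum>j\<in>I. W i x * W j x) = (\<Sum>i\<in>I. \<Sum>j\<in>I. expectation (\<lambda>x. W i x * W j x))"
    using W_prod by simp
  also have "\<dots> = (\<Sum>i\<in>I. variance (Z i))"
    using I by (intro sum.cong refl) (simp add: W_orth)
  finally show "expectation (\<lambda>x. ((\<Sum>i\<in>I. Z i x) - (\<Sum>i\<in>I. expectation (Z i)))\<^sup>2) = (\<Sum>i\<in>I. variance (Z i))"
    by (simp add: eq)
qed

section \<open>Truncated squares summed along a geometric grid\<close>

text \<open>\<open>trunc_sq n\<close> dominates both \<open>n\<close> times the indicator of \<open>{n<..}\<close> (the cost of truncating at \<open>n\<close>)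
  and the normalised truncated second moment, so that one summability statement covers both.\<close>

definition trunc_sq :: "real \<Rightarrow> real \<Rightarrow> real" where
  "trunc_sq n y = (min (max y 0) n)\<^sup>2 / n"

lemma trunc_sq_props:
  assumes "0 < n"
  shows "mono (trunc_sq n)" "continuous_on UNIV (trunc_sq n)" "trunc_sq n 0 = 0"
    "0 \<le> trunc_sq n y" "trunc_sq n y \<le> n"
proof -
  show "mono (trunc_sq n)" unfolding trunc_sq_def
    using assms by (intro monoI divide_right_mono power_mono) auto
  show "continuous_on UNIV (trunc_sq n)" unfolding trunc_sq_def
    using assms by (intro continuous_intros) auto
  show "trunc_sq n 0 = 0" "0 \<le> trunc_sq n y" using assms by (auto simp: trunc_sq_def)
  have "(min (max y 0) n)\<^sup>2 \<le> n\<^sup>2" using assms by (intro power_mono) auto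
  then show "trunc_sq n y \<le> n" using assms by (simp add: trunc_sq_def field_simps power2_eq_square)
qed

text \<open>The terms are \<open>c * 2 ^ a\<close> below \<open>y\<close> and
  \<open>y\<^sup>2 / (c * 2 ^ a)\<close> from \<open>y\<close> on: two geometric series, each at
  most \<open>2 * y\<close>.\<close>

lemma sum_trunc_sq_le:
  assumes "0 < c" "0 \<le> y"
  shows "(\<Sum>a<m. trunc_sq (c * 2 ^ a) y) \<le> 4 * y"
proof -
  \<comment> \<open>a potential whose decrease from \<open>t\<close> to \<open>2 t\<close> pays for the term at \<open>t\<close>\<close>
  define g where "g t = (if t < y then 4 * y - t else 2 * y\<^sup>2 / t)" for t
  have step: "trunc_sq t y \<le> g t - g (2 * t)" if "0 < t" for t
  proof -
    consider "y \<le> t" | "t < y" "y \<le> 2 * t" | "2 * t < y" by linarith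
    then show ?thesis
    proof cases
      case 2
      \<comment> \<open>The only case where the formula for \<open>g\<close> changes between
        \<open>t\<close> and \<open>2 * t\<close>; multiplied by \<open>t\<close>, the claim reads
        \<open>2 * t\<^sup>2 + y\<^sup>2 \<le> 4 * y * t\<close>.\<close>
      have "0 \<le> (y - t) * (3 * t - y) + t * t"
        using 2 that by (intro add_nonneg_nonneg mult_nonneg_nonneg) auto
      also have "\<dots> = 4 * y * t - (t * t + t * t + y * y)" by (simp add: algebra_simps)
      finally have "t * t + t * t + y * y \<le> 4 * y * t" by simp
      then show ?thesis using 2 that assms
        by (simp add: trunc_sq_def g_def field_simps power2_eq_square)
    qed (use that assms in \<open>auto simp: trunc_sq_def g_def field_simps power2_eq_square\<close>)
  qed
  have "(\<Sum>a<m. trunc_sq (c * 2 ^ a) y) \<le> (\<Sum>a<m. g (c * 2 ^ a) - g (c * 2 ^ Suc a))"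
    using step[of "c * 2 ^ a" for a] assms by (intro sum_mono) (simp add: mult.left_commute)
  also have "\<dots> = g c - g (c * 2 ^ m)"
    using sum_lessThan_telescope'[of "\<lambda>a. g (c * 2 ^ a)" m] by simp
  also have "\<dots> \<le> g c"
    using assms by (simp add: g_def)
  also have "\<dots> \<le> 4 * y"
    using assms mult_mono[of y c y "y * 2"] by (auto simp: g_def field_simps power2_eq_square)
  finally show ?thesis .
qed


section \<open>Passing from geometric grids to the full sequence\<close>

text \<open>For \<open>c\<close> in \<open>{L..2 * L}\<close>, consecutive points of the grid \<open>c * 2 ^ a\<close> have ratio at most \<open>1 + 1 / L\<close>,
  so monotonicity interpolates between them at a relative cost that vanishes as \<open>L\<close> grows.\<close>

lemma grid_convergence:
  fixes s e :: "nat \<Rightarrow> real"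
  assumes "mono s" "mono e"
    and grid: "\<And>c. 0 < c \<Longrightarrow> (\<lambda>a. (s (c * 2 ^ a) - e (c * 2 ^ a)) / (c * 2 ^ a)) \<longlonglongrightarrow> 0"
    and incr: "\<And>\<epsilon>::real. 0 < \<epsilon> \<Longrightarrow> \<exists>K\<ge>0. \<forall>m n. m \<le> n \<longrightarrow> e n - e m \<le> K * real (n - m) + \<epsilon> * n"
  shows "(\<lambda>n. (s n - e n) / n) \<longlonglongrightarrow> 0"
proof (rule LIMSEQ_I)
  fix r :: real assume "0 < r"
  \<comment> \<open>The errors at \<open>m\<close> will add up to
    \<open>5 * (\<epsilon> * m)\<close>; the sixth share makes the final inequality strict.\<close>
  define \<epsilon> where "\<epsilon> = r / 6"
  have "0 < \<epsilon>" using \<open>0 < r\<close> by (simp add: \<epsilon>_def)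
  obtain K where K: "0 \<le> K" "\<And>m n. m \<le> n \<Longrightarrow> e n - e m \<le> K * real (n - m) + \<epsilon> * n"
    using incr[OF \<open>0 < \<epsilon>\<close>] by blast
  \<comment> \<open>With \<open>K < \<epsilon> * L\<close>, the linear part of the growth of
    \<open>e\<close> over one grid step \<open>2 ^ a\<close> is at most
    \<open>\<epsilon> * m\<close> as soon as \<open>L * 2 ^ a \<le> m\<close>.\<close>
  obtain L :: nat where L: "K / \<epsilon> < L" using reals_Archimedean2 by blast
  then have "0 < L" using K(1) \<open>0 < \<epsilon>\<close> by (cases L) (auto simp: divide_less_0_iff)
  \<comment> \<open>Finitely many \<open>c\<close> allow a common threshold \<open>A\<close>. The
    endpoint \<open>2 * L\<close> is included because the upper neighbour \<open>Suc c\<close> may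
    reach it.\<close>
  have "\<forall>c\<in>{L..2*L}. \<forall>\<^sub>F a in sequentially. norm ((s (c * 2 ^ a) - e (c * 2 ^ a)) / (c * 2 ^ a) - 0) < \<epsilon>"
    using tendstoD[OF grid \<open>0 < \<epsilon>\<close>] \<open>0 < L\<close> by (auto simp: dist_norm)
  then have "\<forall>\<^sub>F a in sequentially. \<forall>c\<in>{L..2*L}. norm ((s (c * 2 ^ a) - e (c * 2 ^ a)) / (c * 2 ^ a) - 0) < \<epsilon>"
    by (simp add: eventually_ball_finite_distrib)
  then obtain A where A: "\<And>a c. A \<le> a \<Longrightarrow> c \<in> {L..2*L} \<Longrightarrow>
      norm ((s (c * 2 ^ a) - e (c * 2 ^ a)) / (c * 2 ^ a) - 0) < \<epsilon>"
    unfolding eventually_sequentially by blast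
  have A': "\<bar>s (c * 2 ^ a) - e (c * 2 ^ a)\<bar> \<le> \<epsilon> * real (c * 2 ^ a)" if "A \<le> a" "c \<in> {L..2*L}" for a c
  proof -
    have "0 < real (c * 2 ^ a)" using that \<open>0 < L\<close> by auto
    then show ?thesis using A[OF that] by (simp add: abs_mult field_simps)
  qed
  show "\<exists>no. \<forall>m\<ge>no. norm ((s m - e m) / m - 0) < r"
  proof (intro exI allI impI)
    fix m :: nat assume m: "L * 2 ^ A \<le> m"
    \<comment> \<open>Maximality of \<open>a\<close> puts \<open>m div 2 ^ a\<close> into
      \<open>{L..<2 * L}\<close>, and \<open>m\<close> between the grid points
      \<open>c * 2 ^ a\<close> and \<open>Suc c * 2 ^ a\<close>.\<close>
    define a where "a = (GREATEST a. L * 2 ^ a \<le> m)"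
    have bound: "b \<le> m" if "L * 2 ^ b \<le> m" for b
      using that \<open>0 < L\<close> less_exp[of b] mult_le_mono1[of 1 L "2 ^ b"] by linarith
    have "L * 2 ^ a \<le> m" unfolding a_def using m bound by (rule GreatestI_nat)
    have "A \<le> a" unfolding a_def using m bound by (rule Greatest_le_nat)
    have "\<not> L * 2 ^ Suc a \<le> m"
    proof
      assume "L * 2 ^ Suc a \<le> m"
      then have "Suc a \<le> (GREATEST a. L * 2 ^ a \<le> m)" using bound by (rule Greatest_le_nat)
      then show False unfolding a_def[symmetric] by simp
    qed
    then have "m < 2 * L * 2 ^ a" by simp
    define c where "c = m div 2 ^ a"
    have "L \<le> c" unfolding c_def using \<open>L * 2 ^ a \<le> m\<close> by (simp add: less_eq_div_iff_mult_less_eq)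
    have "c < 2 * L" unfolding c_def using \<open>m < 2 * L * 2 ^ a\<close> by (simp add: div_less_iff_less_mult)
    have low: "c * 2 ^ a \<le> m" unfolding c_def by simp
    have "m mod 2 ^ a < 2 ^ a" by simp
    then have up: "m \<le> Suc c * 2 ^ a"
      using div_mult_mod_eq[of m "2 ^ a"] unfolding c_def mult_Suc by linarith
    have "2 ^ a \<le> c * 2 ^ a" using \<open>0 < L\<close> \<open>L \<le> c\<close> by simp
    then have "Suc c * 2 ^ a \<le> 2 * m" using low unfolding mult_Suc by linarith
    then have up2: "real (Suc c * 2 ^ a) \<le> 2 * m" by (metis of_nat_le_iff of_nat_mult of_nat_numeral)
    have low': "real (c * 2 ^ a) \<le> m" using low of_nat_le_iff by blast
    have "0 < m" using m \<open>0 < L\<close> by (metis less_le_trans nat_0_less_mult_iff zero_less_power pos2)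
    have "K * 2 ^ a \<le> \<epsilon> * L * 2 ^ a"
      using L \<open>0 < \<epsilon>\<close> by (intro mult_right_mono) (auto simp: field_simps)
    also have "\<dots> = \<epsilon> * real (L * 2 ^ a)" by simp
    also have "\<dots> \<le> \<epsilon> * m" using \<open>L * 2 ^ a \<le> m\<close> \<open>0 < \<epsilon>\<close>
      by (intro mult_left_mono) (simp_all only: of_nat_le_iff less_imp_le)
    finally have Ka: "K * 2 ^ a \<le> \<epsilon> * m" .
    have \<epsilon>_low: "\<epsilon> * real (c * 2 ^ a) \<le> \<epsilon> * m"
      using low' \<open>0 < \<epsilon>\<close> by (intro mult_left_mono) simp_all
    have "\<epsilon> * real (Suc c * 2 ^ a) \<le> \<epsilon> * (2 * m)"
      using up2 \<open>0 < \<epsilon>\<close> by (intro mult_left_mono) simp_all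
    then have \<epsilon>_up: "\<epsilon> * real (Suc c * 2 ^ a) \<le> 2 * (\<epsilon> * m)"
      by (simp only: mult.left_commute)
    have "e (Suc c * 2 ^ a) - e (c * 2 ^ a) \<le> K * real (Suc c * 2 ^ a - c * 2 ^ a) + \<epsilon> * real (Suc c * 2 ^ a)"
      by (rule K(2)) simp
    moreover have "K * real (Suc c * 2 ^ a - c * 2 ^ a) = K * 2 ^ a" by simp
    ultimately have gap: "e (Suc c * 2 ^ a) - e (c * 2 ^ a) \<le> 3 * (\<epsilon> * m)"
      using Ka \<epsilon>_up by linarith
    have c1: "\<bar>s (c * 2 ^ a) - e (c * 2 ^ a)\<bar> \<le> \<epsilon> * m"
      using \<open>L \<le> c\<close> \<open>c < 2 * L\<close> by (intro order_trans[OF A'[OF \<open>A \<le> a\<close>] \<epsilon>_low]) simp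
    have c2: "\<bar>s (Suc c * 2 ^ a) - e (Suc c * 2 ^ a)\<bar> \<le> 2 * (\<epsilon> * m)"
      using \<open>L \<le> c\<close> \<open>c < 2 * L\<close> by (intro order_trans[OF A'[OF \<open>A \<le> a\<close>] \<epsilon>_up]) simp
    \<comment> \<open>By monotonicity \<open>s m - e m\<close> lies between \<open>s\<close> at the
      lower point minus \<open>e\<close> at the upper one and the reverse; each bound differs from a
      grid error by at most \<open>gap\<close>.\<close>
    have "\<bar>s m - e m\<bar> \<le> 5 * (\<epsilon> * m)"
      using monoD[OF \<open>mono s\<close> low] monoD[OF \<open>mono s\<close> up] monoD[OF \<open>mono e\<close> low] monoD[OF \<open>mono e\<close> up]
        c1 c2 gap by linarith
    also have "\<dots> < r * m" using \<open>0 < m\<close> \<open>0 < r\<close> by (simp add: \<epsilon>_def)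
    finally show "norm ((s m - e m) / m - 0) < r" using \<open>0 < m\<close> by (simp add: field_simps)
  qed
qed

section \<open>The strong law for nonnegative variables\<close>

text \<open>The supremum hypothesis appears multiplied out and for nonnegative variables; the
  positive and the negative parts of the given sequence will both be instances.\<close>

locale cesaro_dominated = prob_space M + N: prob_space N
  for M :: "'a measure" and N :: "'b measure" +
  fixes X :: "nat \<Rightarrow> 'a \<Rightarrow> real" and Y :: "'b \<Rightarrow> real" and C :: real
  assumes X_meas: "\<And>k. 1 \<le> k \<Longrightarrow> X k \<in> borel_measurable M"
    and X_nonneg: "\<And>k x. 0 \<le> X k x"
    and X_indep: "pairwise (\<lambda>i j. indep_var borel (X i) borel (X j)) {1..}"
    and Y_int: "integrable N Y"
    and Y_nonneg: "\<And>x. 0 \<le> Y x"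
    and C_pos: "0 < C"
    and dominated: "\<And>n t. 1 \<le> n \<Longrightarrow> 0 \<le> t \<Longrightarrow>
      (\<Sum>k=1..n. \<P>(x in M. t < X k x)) \<le> C * n * \<P>(x in N. t < Y x)"
begin

lemma Y_meas [measurable]: "Y \<in> borel_measurable N"
  using Y_int by simp

lemma
  assumes \<phi>: "mono \<phi>" "continuous_on UNIV \<phi>" "\<phi> (0::real) = (0::real)"
    and int: "integrable N (\<lambda>x. \<phi> (Y x))"
  shows integrable_comp: "\<And>k. 1 \<le> k \<Longrightarrow> integrable M (\<lambda>x. \<phi> (X k x))"
    and sum_comp_le: "(\<Sum>k=1..n. expectation (\<lambda>x. \<phi> (X k x))) \<le> C * n * N.expectation (\<lambda>x. \<phi> (Y x))"
proof -
  have *: "finite {1..n::nat}" for n by simp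
  \<comment> \<open>\<open>dominated\<close> starts at \<open>n = 1\<close>; for
    \<open>n = 0\<close> both sides are 0.\<close>
  have **: "(\<Sum>k=1..n. \<P>(x in M. t < X k x)) \<le> C * n * \<P>(x in N. t < Y x)" if "0 \<le> t" for n t
    using dominated[of n t] that by (cases n) auto
  \<comment> \<open>The bound for the initial segment \<open>{1..k}\<close> is the first one to
    contain \<open>X k\<close>.\<close>
  show "integrable M (\<lambda>x. \<phi> (X k x))" if "1 \<le> k" for k
    using that C_pos
    by (intro integrable_of_tails(1)[OF finite_measure_axioms N.finite_measure_axioms *[of k]
          X_meas Y_meas X_nonneg Y_nonneg _ ** \<phi> int]) auto
  show "(\<Sum>k=1..n. expectation (\<lambda>x. \<phi> (X k x))) \<le> C * n * N.expectation (\<lambda>x. \<phi> (Y x))"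
    using C_pos
    by (intro integrable_of_tails(2)[OF finite_measure_axioms N.finite_measure_axioms *
          X_meas Y_meas X_nonneg Y_nonneg _ ** \<phi> int]) auto
qed

lemma X_int: "1 \<le> k \<Longrightarrow> integrable M (X k)"
  using integrable_comp[of "\<lambda>x. x"] Y_int by (simp add: mono_def continuous_on_id)

lemma excess_int: "integrable N (\<lambda>x. max (Y x - K) 0)"
  using Y_int by auto

text \<open>The excess over \<open>K\<close> is what truncation at \<open>K\<close> removes. The
  condition \<open>0 \<le> K\<close> makes it vanish at 0, as the tail comparison requires.\<close>

lemma
  assumes "0 \<le> K"
  shows X_excess_int: "1 \<le> k \<Longrightarrow> integrable M (\<lambda>x. max (X k x - K) 0)"
    and sum_excess_le: "(\<Sum>k=1..n. expectation (\<lambda>x. max (X k x - K) 0))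
      \<le> C * n * N.expectation (\<lambda>x. max (Y x - K) 0)"
proof -
  have \<phi>: "mono (\<lambda>z. max (z - K) 0)" "continuous_on UNIV (\<lambda>z. max (z - K) 0)" "max (0 - K) 0 = 0"
    using assms by (auto intro!: monoI continuous_intros)
  show "1 \<le> k \<Longrightarrow> integrable M (\<lambda>x. max (X k x - K) 0)"
    using integrable_comp[OF \<phi> excess_int] .
  show "(\<Sum>k=1..n. expectation (\<lambda>x. max (X k x - K) 0)) \<le> C * n * N.expectation (\<lambda>x. max (Y x - K) 0)"
    using sum_comp_le[OF \<phi> excess_int] .
qed

lemma excess_tendsto_0: "(\<lambda>n. N.expectation (\<lambda>x. max (Y x - real n) 0)) \<longlonglongrightarrow> 0"
proof -
  have "(\<lambda>n. N.expectation (\<lambda>x. max (Y x - real n) 0)) \<longlonglongrightarrow> N.expectation (\<lambda>x. 0)"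
  proof (rule integral_dominated_convergence[where w = Y])
    have "(\<lambda>n. max (Y x - real n) 0) \<longlonglongrightarrow> 0" for x
    proof -
      obtain m :: nat where "Y x < m" using reals_Archimedean2 by blast
      then have "\<forall>\<^sub>F n in sequentially. max (Y x - real n) 0 = 0"
        by (intro eventually_sequentiallyI[of m]) auto
      then show ?thesis by (rule tendsto_eventually)
    qed
    then show "AE x in N. (\<lambda>n. max (Y x - real n) 0) \<longlonglongrightarrow> 0" by simp
  qed (use Y_int Y_nonneg in auto)
  then show ?thesis by simp
qed

definition mean_sum :: "nat \<Rightarrow> real" where
  "mean_sum n = (\<Sum>k=1..n. expectation (X k))"

text \<open>The variables are not identically distributed, so the means need not grow linearly; the tail
  condition makes them uniformly integrable on average, which serves instead.\<close>

lemma mean_sum_increment: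
  fixes \<epsilon> :: real
  assumes "0 < \<epsilon>"
  shows "\<exists>K\<ge>0. \<forall>m n. m \<le> n \<longrightarrow> mean_sum n - mean_sum m \<le> K * real (n - m) + \<epsilon> * n"
proof -
  \<comment> \<open>A level at which the averaged excess of the \<open>X k\<close>, at most
    \<open>C\<close> times that of \<open>Y\<close>, falls below \<open>\<epsilon>\<close>.\<close>
  have "\<forall>\<^sub>F k in sequentially. N.expectation (\<lambda>x. max (Y x - real k) 0) < \<epsilon> / C"
    using excess_tendsto_0 assms C_pos by (intro order_tendstoD) auto
  then obtain K :: nat where K: "N.expectation (\<lambda>x. max (Y x - real K) 0) < \<epsilon> / C"
    by (auto simp: eventually_sequentially)
  have "mean_sum n - mean_sum m \<le> K * real (n - m) + \<epsilon> * n" if "m \<le> n" for m n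
  proof -
    have "{1..n} = {1..m} \<union> {m<..n}" using that by auto
    then have "mean_sum n - mean_sum m = (\<Sum>k\<in>{m<..n}. expectation (X k))"
      unfolding mean_sum_def by (simp add: sum.union_disjoint ivl_disj_int)
    also have "\<dots> \<le> (\<Sum>k\<in>{m<..n}. K + expectation (\<lambda>x. max (X k x - K) 0))"
    proof (rule sum_mono)
      fix k assume "k \<in> {m<..n}"
      then have "1 \<le> k" by auto
      then have "expectation (X k) \<le> expectation (\<lambda>x. K + max (X k x - K) 0)"
        using X_int X_excess_int[of K k] by (intro integral_mono) auto
      then show "expectation (X k) \<le> K + expectation (\<lambda>x. max (X k x - K) 0)"
        using X_excess_int[of K k] \<open>1 \<le> k\<close> by (simp add: prob_space)
    qed
    also have "\<dots> = K * real (n - m) + (\<Sum>k\<in>{m<..n}. expectation (\<lambda>x. max (X k x - K) 0))"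
      by (simp add: sum.distrib)
    \<comment> \<open>Domination controls only averages over initial segments, so the window is
      enlarged to \<open>{1..n}\<close>; hence the error \<open>\<epsilon> * n\<close> rather than
      \<open>\<epsilon> * (n - m)\<close>.\<close>
    also have "(\<Sum>k\<in>{m<..n}. expectation (\<lambda>x. max (X k x - K) 0))
        \<le> (\<Sum>k=1..n. expectation (\<lambda>x. max (X k x - K) 0))"
      by (intro sum_mono2) (auto intro!: integral_nonneg_AE)
    also have "\<dots> \<le> C * n * N.expectation (\<lambda>x. max (Y x - K) 0)"
      by (rule sum_excess_le) simp
    also have "\<dots> \<le> C * n * (\<epsilon> / C)"
      using K C_pos by (intro mult_left_mono) auto
    finally show ?thesis using C_pos by (simp add: mult.commute)
  qed
  then show ?thesis by (intro exI[of _ "real K"]) auto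
qed

lemma trunc_sq_Y_int:
  assumes "0 < n"
  shows "integrable N (\<lambda>x. trunc_sq n (Y x))"
proof (rule N.integrable_const_bound)
  show "AE x in N. norm (trunc_sq n (Y x)) \<le> n"
    using trunc_sq_props(4,5)[OF assms] by simp
  show "(\<lambda>x. trunc_sq n (Y x)) \<in> borel_measurable N"
    by (rule measurable_compose[OF Y_meas borel_measurable_continuous_onI[OF trunc_sq_props(2)[OF assms]]])
qed

text \<open>The pointwise bound \<open>4 * Y\<close> is uniform in the number of terms, so the first
  moment of \<open>Y\<close> bounds all partial sums.\<close>

lemma summable_trunc_sq:
  assumes "0 < c"
  shows "summable (\<lambda>a. N.expectation (\<lambda>x. trunc_sq (c * 2 ^ a) (Y x)))"
proof (rule summableI_nonneg_bounded)
  show "0 \<le> N.expectation (\<lambda>x. trunc_sq (c * 2 ^ a) (Y x))" for a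
    using assms by (intro integral_nonneg_AE) (auto simp: trunc_sq_props)
  fix m
  have "(\<Sum>a<m. N.expectation (\<lambda>x. trunc_sq (c * 2 ^ a) (Y x)))
      = N.expectation (\<lambda>x. \<Sum>a<m. trunc_sq (c * 2 ^ a) (Y x))"
    using assms by (subst Bochner_Integration.integral_sum) (auto intro!: trunc_sq_Y_int)
  also have "\<dots> \<le> N.expectation (\<lambda>x. 4 * Y x)"
    using assms Y_int Y_nonneg
    by (intro integral_mono) (auto intro!: trunc_sq_Y_int sum_trunc_sq_le)
  finally show "(\<Sum>a<m. N.expectation (\<lambda>x. trunc_sq (c * 2 ^ a) (Y x))) \<le> N.expectation (\<lambda>x. 4 * Y x)" .
qed

text \<open>Borel-Cantelli: the common level \<open>n = c * 2 ^ a\<close> lets a union bound over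
  \<open>k\<close> meet the averaged tail hypothesis.\<close>

lemma AE_le_along_grid:
  assumes "0 < c"
  shows "AE x in M. \<forall>\<^sub>F a in sequentially. \<forall>k\<in>{1..c * 2 ^ a}. X k x \<le> real (c * 2 ^ a)"
proof -
  define A where "A a = (\<Union>k\<in>{1..c * 2 ^ a}. {x\<in>space M. real (c * 2 ^ a) < X k x})" for a
  have [measurable]: "{x\<in>space M. t < X k x} \<in> sets M" if "1 \<le> k" for k t
    using X_meas[OF that] by measurable
  have A_sets: "A a \<in> sets M" for a
    unfolding A_def by (intro sets.finite_UN) auto
  have A_le: "measure M (A a) \<le> C * N.expectation (\<lambda>x. trunc_sq (real c * 2 ^ a) (Y x))" for a
  proof -
    define n where "n = c * 2 ^ a"
    have "0 < n" using assms by (simp add: n_def)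
    have "measure M (A a) \<le> (\<Sum>k\<in>{1..n}. \<P>(x in M. n < X k x))"
      unfolding A_def n_def[symmetric] by (intro finite_measure_subadditive_finite) auto
    also have "\<dots> \<le> C * n * \<P>(x in N. n < Y x)"
      using \<open>0 < n\<close> by (intro dominated) auto
    also have "\<dots> = C * N.expectation (\<lambda>x. real n * indicator {x\<in>space N. n < Y x} x)"
      by simp
    also have "\<dots> \<le> C * N.expectation (\<lambda>x. trunc_sq n (Y x))"
    proof (intro mult_left_mono integral_mono trunc_sq_Y_int)
      \<comment> \<open>Equality holds where \<open>n < Y x\<close>; elsewhere the left side is
        0.\<close>
      show "real n * indicator {x\<in>space N. n < Y x} x \<le> trunc_sq n (Y x)" for x
        using \<open>0 < n\<close> trunc_sq_props(4)[of n "Y x"]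
        by (auto simp: indicator_def trunc_sq_def power2_eq_square)
    qed (use \<open>0 < n\<close> C_pos in \<open>auto simp: N.emeasure_eq_measure\<close>)
    finally show ?thesis by (simp add: n_def)
  qed
  have "summable (\<lambda>a. measure M (A a))"
    by (rule summable_comparison_test'[OF summable_mult[OF summable_trunc_sq[of c], of C], of 0])
       (use A_le assms in auto)
  then have "AE x in M. \<forall>\<^sub>F a in sequentially. x \<in> space M - A a"
    by (intro borel_cantelli_AE1 A_sets) (auto simp: emeasure_eq_measure)
  then show ?thesis
    by eventually_elim (auto simp: A_def elim!: eventually_mono)
qed

text \<open>The normalised centred sums have second moments summable along the grid, so their
  squares tend to 0 almost surely.\<close>

lemma AE_truncated_along_grid:
  assumes "0 < c"
  shows "AE x in M. (\<lambda>a. ((\<Sum>k=1..c * 2 ^ a. min (X k x) (real (c * 2 ^ a)))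
      - (\<Sum>k=1..c * 2 ^ a. expectation (\<lambda>x. min (X k x) (real (c * 2 ^ a))))) / real (c * 2 ^ a)) \<longlonglongrightarrow> 0"
proof -
  define D where "D n x = (\<Sum>k=1..n. min (X k x) (real n)) - (\<Sum>k=1..n. expectation (\<lambda>x. min (X k x) (real n)))"
    for n :: nat and x
  have D: "integrable M (\<lambda>x. (D n x / n)\<^sup>2)"
      "expectation (\<lambda>x. (D n x / n)\<^sup>2) \<le> C * N.expectation (\<lambda>x. trunc_sq n (Y x))" if "0 < n" for n :: nat
  proof -
    define Z where "Z k x = min (X k x) (real n)" for k x
    \<comment> \<open>As \<open>X k\<close> is nonnegative, the squared truncation is a multiple of
      the monotone function \<open>trunc_sq n\<close>, to which \<open>sum_comp_le\<close>
      applies.\<close>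
    have sq: "(Z k x)\<^sup>2 = n * trunc_sq n (X k x)" for k x
      using that X_nonneg[of k x] by (simp add: Z_def trunc_sq_def)
    have indep: "pairwise (\<lambda>i j. indep_var borel (Z i) borel (Z j)) {1..n}"
    proof (rule pairwiseI)
      fix i j assume "i \<in> {1..n}" "j \<in> {1..n}" "i \<noteq> j"
      then have "indep_var borel ((\<lambda>z. min z (real n)) \<circ> X i) borel ((\<lambda>z. min z (real n)) \<circ> X j)"
        using X_indep by (intro indep_var_compose[where ?M1.0=borel and ?M2.0=borel]) (auto simp: pairwise_def)
      then show "indep_var borel (Z i) borel (Z j)" by (simp add: Z_def[abs_def] comp_def)
    qed
    have Z_meas: "Z k \<in> borel_measurable M" if "k \<in> {1..n}" for k
      using that X_meas[of k] unfolding Z_def[abs_def] by (intro borel_measurable_min) auto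
    have tX_int: "integrable M (\<lambda>x. trunc_sq n (X k x))" if "k \<in> {1..n}" for k
      using that by (intro integrable_comp trunc_sq_props trunc_sq_Y_int) auto
    have Z_sq: "integrable M (\<lambda>x. (Z k x)\<^sup>2)" if "k \<in> {1..n}" for k
      unfolding sq using tX_int[OF that] by simp
    have Z_int: "integrable M (Z k)" if "k \<in> {1..n}" for k
      using Z_meas[OF that] Z_sq[OF that] by (rule square_integrable_imp_integrable)
    note var = variance_sum_pairwise_indep[OF finite_atLeastAtMost indep Z_meas Z_sq]
    have D_eq: "D n x = (\<Sum>k=1..n. Z k x) - (\<Sum>k=1..n. expectation (Z k))" for x
      by (simp add: D_def Z_def[abs_def])
    show "integrable M (\<lambda>x. (D n x / n)\<^sup>2)"
      unfolding D_eq power_divide using var(1) by simp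
    have "expectation (\<lambda>x. (D n x)\<^sup>2) = (\<Sum>k=1..n. variance (Z k))"
      unfolding D_eq using var(2) by simp
    also have "\<dots> \<le> (\<Sum>k=1..n. expectation (\<lambda>x. (Z k x)\<^sup>2))"
      by (intro sum_mono) (subst variance_eq, auto intro: Z_int Z_sq)
    \<comment> \<open>One factor \<open>n\<close> comes from this rescaling and another from the
      averaged tail bound; together they cancel the \<open>n\<^sup>2\<close> of the
      normalisation.\<close>
    also have "\<dots> = n * (\<Sum>k=1..n. expectation (\<lambda>x. trunc_sq n (X k x)))"
      unfolding sq by (simp add: sum_distrib_left)
    also have "\<dots> \<le> n * (C * n * N.expectation (\<lambda>x. trunc_sq n (Y x)))"
      using that by (intro mult_left_mono sum_comp_le trunc_sq_props trunc_sq_Y_int) auto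
    finally show "expectation (\<lambda>x. (D n x / n)\<^sup>2) \<le> C * N.expectation (\<lambda>x. trunc_sq n (Y x))"
      using that by (simp add: power_divide field_simps power2_eq_square)
  qed
  have pos: "0 < c * 2 ^ a" for a :: nat using assms by simp
  have "AE x in M. (\<lambda>a. (D (c * 2 ^ a) x / real (c * 2 ^ a))\<^sup>2) \<longlonglongrightarrow> 0"
  proof (rule AE_tendsto_0_of_summable_integral)
    show "summable (\<lambda>a. expectation (\<lambda>x. (D (c * 2 ^ a) x / real (c * 2 ^ a))\<^sup>2))"
      by (rule summable_comparison_test'[OF summable_mult[OF summable_trunc_sq[of c], of C], of 0])
         (use D(2)[OF pos] assms in auto)
  qed (use D(1)[OF pos] in auto)
  then show ?thesis
    unfolding D_def by eventually_elim (simp add: power_tendsto_0_iff)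
qed

text \<open>Truncation is undone twice: for the values because almost surely nothing exceeds the
  level far out on the grid, for the means because the normalised loss is at most \<open>C\<close>
  times the vanishing excess of \<open>Y\<close>.\<close>

lemma AE_along_grid:
  assumes "0 < c"
  shows "AE x in M. (\<lambda>a. ((\<Sum>k=1..c * 2 ^ a. X k x) - mean_sum (c * 2 ^ a)) / real (c * 2 ^ a)) \<longlonglongrightarrow> 0"
proof -
  define \<mu> where "\<mu> n = (\<Sum>k=1..n. expectation (\<lambda>x. min (X k x) (real n)))" for n :: nat
  have diff: "mean_sum n - \<mu> n = (\<Sum>k=1..n. expectation (\<lambda>x. max (X k x - real n) 0))" for n
    unfolding mean_sum_def \<mu>_def sum_subtractf[symmetric]
  proof (intro sum.cong refl)
    fix k assume "k \<in> {1..n}"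
    then have k: "integrable M (X k)" "integrable M (\<lambda>x. min (X k x) (real n))" using X_int[of k] by auto
    have "max (X k x - real n) 0 = X k x - min (X k x) (real n)" for x by auto
    then show "expectation (X k) - expectation (\<lambda>x. min (X k x) (real n)) = expectation (\<lambda>x. max (X k x - real n) 0)"
      using k by simp
  qed
  have lim: "(\<lambda>n. (mean_sum n - \<mu> n) / n) \<longlonglongrightarrow> 0"
  proof (rule tendsto_sandwich[OF _ _ tendsto_const])
    show "(\<lambda>n. C * N.expectation (\<lambda>x. max (Y x - real n) 0)) \<longlonglongrightarrow> 0"
      using tendsto_mult_right_zero[OF excess_tendsto_0] .
    show "\<forall>\<^sub>F n in sequentially. 0 \<le> (mean_sum n - \<mu> n) / n"
      unfolding diff by (intro always_eventually allI divide_nonneg_nonneg sum_nonneg integral_nonneg_AE) auto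
    show "\<forall>\<^sub>F n in sequentially. (mean_sum n - \<mu> n) / n \<le> C * N.expectation (\<lambda>x. max (Y x - real n) 0)"
    proof (rule eventually_sequentiallyI[of 1])
      fix n :: nat assume "1 \<le> n"
      then show "(mean_sum n - \<mu> n) / n \<le> C * N.expectation (\<lambda>x. max (Y x - real n) 0)"
        unfolding diff using sum_excess_le[of "real n" n] by (simp add: field_simps)
    qed
  qed
  have "filterlim (\<lambda>a. c * 2 ^ a) sequentially sequentially"
  proof (rule filterlim_subseq, rule strict_monoI)
    show "c * 2 ^ a < c * 2 ^ b" if "a < b" for a b :: nat using that assms by simp
  qed
  from filterlim_compose[OF lim this]
  have lim': "(\<lambda>a. (mean_sum (c * 2 ^ a) - \<mu> (c * 2 ^ a)) / real (c * 2 ^ a)) \<longlonglongrightarrow> 0" .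
  from AE_truncated_along_grid[OF assms] AE_le_along_grid[OF assms] show ?thesis
  proof eventually_elim
    case (elim x)
    have "(\<lambda>a. ((\<Sum>k=1..c * 2 ^ a. min (X k x) (real (c * 2 ^ a))) - \<mu> (c * 2 ^ a)) / real (c * 2 ^ a)
        - (mean_sum (c * 2 ^ a) - \<mu> (c * 2 ^ a)) / real (c * 2 ^ a)) \<longlonglongrightarrow> 0"
      using tendsto_diff[OF elim(1) lim'] by (simp add: \<mu>_def)
    then show ?case
    proof (rule Lim_transform_eventually)
      show "\<forall>\<^sub>F a in sequentially. ((\<Sum>k=1..c * 2 ^ a. min (X k x) (real (c * 2 ^ a))) - \<mu> (c * 2 ^ a)) / real (c * 2 ^ a)
        - (mean_sum (c * 2 ^ a) - \<mu> (c * 2 ^ a)) / real (c * 2 ^ a)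
        = ((\<Sum>k=1..c * 2 ^ a. X k x) - mean_sum (c * 2 ^ a)) / real (c * 2 ^ a)"
        using elim(2)
      proof eventually_elim
        case (elim a)
        then have "(\<Sum>k=1..c * 2 ^ a. min (X k x) (real (c * 2 ^ a))) = (\<Sum>k=1..c * 2 ^ a. X k x)"
          by (intro sum.cong refl min_absorb1) auto
        then show ?case by (simp add: diff_divide_distrib)
      qed
    qed
  qed
qed

lemma strong_law:
  "AE x in M. (\<lambda>n. ((\<Sum>k=1..n. X k x) - (\<Sum>k=1..n. expectation (X k))) / n) \<longlonglongrightarrow> 0"
proof -
  \<comment> \<open>Only countably many \<open>c\<close> occur, so one null set serves all grids and
    \<open>grid_convergence\<close> can be applied at a fixed sample point.\<close>
  have "AE x in M. \<forall>c\<in>{0<..}. (\<lambda>a. ((\<Sum>k=1..c * 2 ^ a. X k x) - mean_sum (c * 2 ^ a)) / real (c * 2 ^ a)) \<longlonglongrightarrow> 0"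
    by (rule AE_ball_countable[THEN iffD2]) (use AE_along_grid in \<open>simp_all del: of_nat_mult of_nat_power\<close>)
  then show ?thesis
  proof eventually_elim
    case (elim x)
    have "mono (\<lambda>n. \<Sum>k=1..n. X k x)"
      using X_nonneg by (intro monoI sum_mono2) auto
    moreover have "mono mean_sum"
      unfolding mean_sum_def using X_nonneg by (intro monoI sum_mono2) (auto intro: integral_nonneg_AE)
    ultimately have "(\<lambda>n. ((\<Sum>k=1..n. X k x) - mean_sum n) / n) \<longlonglongrightarrow> 0"
      using elim mean_sum_increment by (intro grid_convergence) auto
    then show ?case by (simp add: mean_sum_def)
  qed
qed

end

section \<open>Reduction to positive and negative parts\<close>

theorem corollary1:
  fixes M :: "'a measure" and X :: "nat \<Rightarrow> 'a \<Rightarrow> real"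
    and N :: "'b measure" and Y :: "'b \<Rightarrow> real" and C :: real
  assumes "prob_space M"
    and "\<And>n. n \<ge> 1 \<Longrightarrow> X n \<in> borel_measurable M"
    and "pairwise (\<lambda>i j. prob_space.indep_var M borel (X i) borel (X j)) {1..}"
    and "prob_space N"
    and "Y \<in> borel_measurable N"
    and "integrable N (\<lambda>\<omega>. \<bar>Y \<omega>\<bar>)"
    and "C > 0"
    and "\<And>x::real. x \<ge> 0 \<Longrightarrow>
           (SUP n\<in>{1::nat..}. 1 / real n * (\<Sum>k=1..n. \<P>(\<omega> in M. \<bar>X k \<omega>\<bar> > x)))
             \<le> C * \<P>(\<omega> in N. \<bar>Y \<omega>\<bar> > x)"
  shows "AE \<omega> in M.
           (\<lambda>n. ((\<Sum>k=1..n. X k \<omega>) - (\<integral>\<omega>'. (\<Sum>k=1..n. X k \<omega>') \<partial>M)) / real n)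
             \<longlonglongrightarrow> 0"
proof -
  interpret M: prob_space M by fact
  interpret N: prob_space N by fact
  have avg: "(\<Sum>k=1..n. \<P>(\<omega> in M. t < \<bar>X k \<omega>\<bar>)) \<le> C * n * \<P>(\<omega> in N. t < \<bar>Y \<omega>\<bar>)"
    if "1 \<le> n" "0 \<le> t" for n :: nat and t
  proof -
    have "1 / real n * (\<Sum>k=1..n. \<P>(\<omega> in M. t < \<bar>X k \<omega>\<bar>))
        \<le> (SUP n\<in>{1::nat..}. 1 / real n * (\<Sum>k=1..n. \<P>(\<omega> in M. t < \<bar>X k \<omega>\<bar>)))"
    \<comment> \<open>A real supremum bounds its members only when the set is bounded above;
      averages of probabilities are at most 1.\<close>
    proof (rule cSUP_upper)
      show "bdd_above ((\<lambda>n. 1 / real n * (\<Sum>k=1..n. \<P>(\<omega> in M. t < \<bar>X k \<omega>\<bar>))) ` {1..})"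
      proof (rule bdd_aboveI2[of _ _ 1])
        fix n :: nat assume "n \<in> {1..}"
        moreover have "(\<Sum>k=1..n. \<P>(\<omega> in M. t < \<bar>X k \<omega>\<bar>)) \<le> (\<Sum>k=1..n. 1)"
          by (intro sum_mono) simp
        ultimately show "1 / real n * (\<Sum>k=1..n. \<P>(\<omega> in M. t < \<bar>X k \<omega>\<bar>)) \<le> 1"
          by (simp add: field_simps)
      qed
    qed (use that in auto)
    also have "\<dots> \<le> C * \<P>(\<omega> in N. t < \<bar>Y \<omega>\<bar>)"
      using assms(8) that by simp
    finally show ?thesis using that by (simp add: field_simps)
  qed
  \<comment> \<open>\<open>\<sigma>\<close> selects the positive or the negative part. Both have
    tails below those of \<open>\<bar>X k\<bar>\<close>, and both are images of \<open>X k\<close>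
    under one Borel function, so pairwise independence persists.\<close>
  have dom: "cesaro_dominated M N (\<lambda>k x. max (\<sigma> * X k x) 0) (\<lambda>x. \<bar>Y x\<bar>) C"
    if \<sigma>: "\<sigma> \<in> {1, -1}" for \<sigma> :: real
  proof unfold_locales
    show "(\<lambda>x. max (\<sigma> * X k x) 0) \<in> borel_measurable M" if "1 \<le> k" for k
      using assms(2)[OF that] by measurable
    show "pairwise (\<lambda>i j. M.indep_var borel (\<lambda>x. max (\<sigma> * X i x) 0) borel (\<lambda>x. max (\<sigma> * X j x) 0)) {1..}"
    proof (rule pairwiseI)
      fix i j :: nat assume "i \<in> {1..}" "j \<in> {1..}" "i \<noteq> j"
      then have "M.indep_var borel ((\<lambda>z. max (\<sigma> * z) 0) \<circ> X i) borel ((\<lambda>z. max (\<sigma> * z) 0) \<circ> X j)"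
        using assms(3) by (intro M.indep_var_compose[where ?M1.0=borel and ?M2.0=borel]) (auto simp: pairwise_def)
      then show "M.indep_var borel (\<lambda>x. max (\<sigma> * X i x) 0) borel (\<lambda>x. max (\<sigma> * X j x) 0)"
        by (simp add: comp_def)
    qed
    show "(\<Sum>k=1..n. \<P>(x in M. t < max (\<sigma> * X k x) 0)) \<le> C * n * \<P>(x in N. t < \<bar>Y x\<bar>)"
      if "1 \<le> n" "0 \<le> t" for n :: nat and t
    proof -
      have "(\<Sum>k=1..n. \<P>(x in M. t < max (\<sigma> * X k x) 0)) \<le> (\<Sum>k=1..n. \<P>(x in M. t < \<bar>X k x\<bar>))"
      proof (intro sum_mono M.finite_measure_mono)
        fix k assume "k \<in> {1..n}"
        then have [measurable]: "X k \<in> borel_measurable M" by (simp add: assms(2))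
        show "{x\<in>space M. t < \<bar>X k x\<bar>} \<in> sets M" by measurable
        show "{x\<in>space M. t < max (\<sigma> * X k x) 0} \<subseteq> {x\<in>space M. t < \<bar>X k x\<bar>}"
          using \<sigma> that by auto
      qed
      then show ?thesis using avg[OF that] by linarith
    qed
  qed (use assms in auto)
  interpret P: cesaro_dominated M N "\<lambda>k x. max (1 * X k x) 0" "\<lambda>x. \<bar>Y x\<bar>" C
    by (rule dom) simp
  interpret Q: cesaro_dominated M N "\<lambda>k x. max (-1 * X k x) 0" "\<lambda>x. \<bar>Y x\<bar>" C
    by (rule dom) simp
  have X_eq: "X k x = max (1 * X k x) 0 - max (-1 * X k x) 0" for k x
    by auto
  \<comment> \<open>Integrability must be known before the expectation of the sum splits, since the
    Bochner integral of a nonintegrable function is 0 by convention.\<close>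
  have "(\<integral>x. X k x \<partial>M) = (\<integral>x. max (1 * X k x) 0 \<partial>M) - (\<integral>x. max (-1 * X k x) 0 \<partial>M)"
      and "integrable M (X k)" if "1 \<le> k" for k
    using P.X_int[OF that] Q.X_int[OF that]
    by (subst X_eq[abs_def], simp)+
  then have mean: "(\<integral>x. (\<Sum>k=1..n. X k x) \<partial>M)
      = (\<Sum>k=1..n. \<integral>x. max (1 * X k x) 0 \<partial>M) - (\<Sum>k=1..n. \<integral>x. max (-1 * X k x) 0 \<partial>M)" for n :: nat
    by (subst Bochner_Integration.integral_sum) (auto simp: sum_subtractf[symmetric] intro!: sum.cong)
  have sum: "(\<Sum>k=1..n. X k x) = (\<Sum>k=1..n. max (1 * X k x) 0) - (\<Sum>k=1..n. max (-1 * X k x) 0)" for n :: nat and x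
    by (subst sum_subtractf[symmetric]) (intro sum.cong refl X_eq)
  from P.strong_law Q.strong_law show ?thesis
  proof eventually_elim
    case (elim x)
    have "((\<Sum>k=1..n. X k x) - (\<integral>x. (\<Sum>k=1..n. X k x) \<partial>M)) / real n
      = ((\<Sum>k=1..n. max (1 * X k x) 0) - (\<Sum>k=1..n. \<integral>x. max (1 * X k x) 0 \<partial>M)) / n
        - ((\<Sum>k=1..n. max (-1 * X k x) 0) - (\<Sum>k=1..n. \<integral>x. max (-1 * X k x) 0 \<partial>M)) / n" for n :: nat
      unfolding mean unfolding sum by (simp add: diff_divide_distrib)
    then show ?case using tendsto_diff[OF elim] by simp
  qed
qed

end
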